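(* If a non-sequential $N$-DM system possesses Property C, then it possesses Property SM.
   Context: **Model.** A non-sequential system with $N\in\mathbb{N}$ decision makers (DMs) consists of: a probability space $(\Omega,\mathcal{F},P)$; standard Borel action spaces $(\mathbb{U}^i,\mathcal{U}^i)$ and standard Borel measurement spaces $(\mathbb{Y}^i,\mathcal{Y}^i)$, $i=1,\dots,N$; measurable measurement functions $\eta^i:\Omega\times\prod_{k=1}^N\mathbb{U}^k\to\mathbb{Y}^i$, giving the measurement $y^i=\eta^i(\omega,\mathbf{u})$ of DM $i$, where $\mathbf{u}=(u^1,\dots,u^N)$. An admissible policy is $\gamma=(\gamma^1,\dots,\gamma^N)\in\Gamma$ with each $\gamma^i:\mathbb{Y}^i\to\mathbb{U}^i$ measurable, $u^i=\gamma^i(y^i)$. **Orderings.** For $k=1,\dots,N$, $S_k$ is the set of $k$-DM orderings $(s_1,\dots,s_k)$ (sequences of $k$ distinct elements of $\{1,\dots,N\}$); $s_j=i$ means that DM $i$ is the $j$-th to act. $T^N_k:S_N\to S_k$ is truncation to the first $k$ entries. An ordering map is a map $\psi:\Omega\times\prod_i\mathbb{U}^i\to S_N$, $\psi(\omega,\mathbf{u})=(s_1,\dots,s_N)$. **Induced objects.** Given $\psi$, let $\bar y^k=\sum_i\eta^i(\omega,\mathbf{u})1_{\{s_k=i\}}$ (i.e. $\bar y^k=\eta^i(\omega,\mathbf{u})$ when $s_k=i$) and $\bar u^k=\sum_iu^i1_{\{s_k=i\}}$ (i.e. $\bar u^k=u^i$ when $s_k=i$), with values in $\bigcup_i\mathbb{Y}^i$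 and $\bigcup_i\mathbb{U}^i$, regarded as standard Borel spaces containing the $\mathbb{Y}^i$ (resp. $\mathbb{U}^i$) as measurable subspaces. $\bar{\mathscr{J}}^k$ is the smallest $\sigma$-algebra on $\Omega\times\prod_i\mathbb{U}^i$ making $\bar y^k$ measurable, and $\mathscr{F}^*(k)$ the smallest one making $(\omega,\bar u^1,\dots,\bar u^k)$ measurable ($\mathscr{F}^*(0)$: making $\omega$ measurable). **Property C (Causality).** There exists an ordering map $\psi$ such that for all $k\in\{1,\dots,N\}$ and $s\in S_k$, $\{E\cap[T^N_k\circ\psi]^{-1}(s)\mid E\in\bar{\mathscr{J}}^k\}\subseteq\mathscr{F}^*(k-1)$. **Property SM (Solvability-measurability).** For each $\gamma\in\Gamma$ and $\omega\in\Omega$ there is one and only one $\mathbf{u}\in\prod_i\mathbb{U}^i$ satisfying the closed-loop equations $u^i=\gamma^i(\eta^i(\omega,\mathbf{u}))$, $i=1,\dots,N$, and the resulting solution map $M^\gamma:(\Omega,\mathcal{F})\to(\prod_i\mathbb{U}^i,\mathcal{B}(\prod_i\mathbb{U}^i))$, $\omega\mapsto\mathbf{u}$, is measurable. *)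

theory Defs
  imports "HOL-Probability.Probability"
begin

text \<open>The spaces of the individual decision makers live inside common types \<open>'u\<close> (actions) and
  \<open>'y\<close> (measurements); they may overlap or be disjoint. The type \<open>measure\<close> is used for measurable
  spaces: apart from the probability measure, only \<open>space\<close> and \<open>sets\<close> matter.\<close>

definition standard_borel :: "'a measure \<Rightarrow> bool" where
  "standard_borel M \<longleftrightarrow>
     (\<exists>T. completely_metrizable_space T \<and> separable_space T \<and>
          space M = topspace T \<and> sets M = sigma_sets (topspace T) {A. openin T A})"

definition measurable_subspace :: "'a measure \<Rightarrow> 'a measure \<Rightarrow> bool" where
  "measurable_subspace M L \<longleftrightarrow>
     space M \<in> sets L \<and> sets M = sets (restrict_space L (space M))"

definition standard_borel_union :: "'i set \<Rightarrow> ('i \<Rightarrow> 'a measure) \<Rightarrow> 'a measure \<Rightarrow> bool" where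
  "standard_borel_union I X L \<longleftrightarrow>
     standard_borel L \<and> space L = (\<Union>i\<in>I. space (X i)) \<and>
     (\<forall>i\<in>I. measurable_subspace (X i) L)"

text \<open>The sigma-algebra of \<open>Pi\<^sub>M {1..N} U\<close> is the Borel sigma-algebra of the product, since the
  factors are standard Borel. Its points are extensional functions on \<open>{1..N}\<close>.\<close>

abbreviation system_space ::
  "nat \<Rightarrow> 'w measure \<Rightarrow> (nat \<Rightarrow> 'u measure) \<Rightarrow> ('w \<times> (nat \<Rightarrow> 'u)) measure" where
  "system_space N P U \<equiv> P \<Otimes>\<^sub>M Pi\<^sub>M {1..N} U"

text \<open>Action spaces are nonempty by convention. With an empty action space and an empty
  measurement space no closed-loop solution can exist, although an admissible policy does.\<close>

locale nonsequential_system =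
  fixes N :: nat
    and P :: "'w measure"
    and U :: "nat \<Rightarrow> 'u measure"
    and Y :: "nat \<Rightarrow> 'y measure"
    and Ubar :: "'u measure"
    and Ybar :: "'y measure"
    and \<eta> :: "nat \<Rightarrow> 'w \<times> (nat \<Rightarrow> 'u) \<Rightarrow> 'y"
  assumes prob: "prob_space P"
    and standard_borel_U: "\<And>i. i \<in> {1..N} \<Longrightarrow> standard_borel (U i)"
    and nonempty_U: "\<And>i. i \<in> {1..N} \<Longrightarrow> space (U i) \<noteq> {}"
    and standard_borel_Y: "\<And>i. i \<in> {1..N} \<Longrightarrow> standard_borel (Y i)"
    and union_U: "standard_borel_union {1..N} U Ubar"
    and union_Y: "standard_borel_union {1..N} Y Ybar"
    and measurable_\<eta>: "\<And>i. i \<in> {1..N} \<Longrightarrow> \<eta> i \<in> system_space N P U \<rightarrow>\<^sub>M Y i"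

definition policies ::
  "nat \<Rightarrow> (nat \<Rightarrow> 'u measure) \<Rightarrow> (nat \<Rightarrow> 'y measure) \<Rightarrow> (nat \<Rightarrow> 'y \<Rightarrow> 'u) set" where
  "policies N U Y = {\<gamma>. \<forall>i\<in>{1..N}. \<gamma> i \<in> Y i \<rightarrow>\<^sub>M U i}"

text \<open>Truncation to the first \<open>k\<close> entries is \<^const>\<open>take\<close>; since list positions start at 0, the \<open>k\<close>-th
  decision maker to act in the ordering \<open>s\<close> is \<open>s ! (k - 1)\<close>.\<close>

definition orderings :: "nat \<Rightarrow> nat \<Rightarrow> nat list set" where
  "orderings N k = {s. length s = k \<and> distinct s \<and> set s \<subseteq> {1..N}}"

text \<open>No measurability is required of an ordering map.\<close>

definition ordering_map ::
  "nat \<Rightarrow> 'w measure \<Rightarrow> (nat \<Rightarrow> 'u measure) \<Rightarrow> ('w \<times> (nat \<Rightarrow> 'u) \<Rightarrow> nat list) \<Rightarrow> bool" where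
  "ordering_map N P U \<psi> \<longleftrightarrow> \<psi> \<in> space (system_space N P U) \<rightarrow> orderings N N"

definition ybar ::
  "(nat \<Rightarrow> 'w \<times> (nat \<Rightarrow> 'u) \<Rightarrow> 'y) \<Rightarrow> ('w \<times> (nat \<Rightarrow> 'u) \<Rightarrow> nat list) \<Rightarrow> nat \<Rightarrow>
     'w \<times> (nat \<Rightarrow> 'u) \<Rightarrow> 'y" where
  "ybar \<eta> \<psi> k x = \<eta> (\<psi> x ! (k - 1)) x"

definition ubar ::
  "('w \<times> (nat \<Rightarrow> 'u) \<Rightarrow> nat list) \<Rightarrow> nat \<Rightarrow> 'w \<times> (nat \<Rightarrow> 'u) \<Rightarrow> 'u" where
  "ubar \<psi> k x = snd x (\<psi> x ! (k - 1))"

definition Jbar ::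
  "nat \<Rightarrow> 'w measure \<Rightarrow> (nat \<Rightarrow> 'u measure) \<Rightarrow> 'y measure \<Rightarrow> (nat \<Rightarrow> 'w \<times> (nat \<Rightarrow> 'u) \<Rightarrow> 'y) \<Rightarrow>
     ('w \<times> (nat \<Rightarrow> 'u) \<Rightarrow> nat list) \<Rightarrow> nat \<Rightarrow> ('w \<times> (nat \<Rightarrow> 'u)) measure" where
  "Jbar N P U Ybar \<eta> \<psi> k = vimage_algebra (space (system_space N P U)) (ybar \<eta> \<psi> k) Ybar"

text \<open>For \<open>k = 0\<close> the second component is constant, so only \<open>\<omega>\<close> is made measurable.\<close>

definition Fstar ::
  "nat \<Rightarrow> 'w measure \<Rightarrow> (nat \<Rightarrow> 'u measure) \<Rightarrow> 'u measure \<Rightarrow>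
     ('w \<times> (nat \<Rightarrow> 'u) \<Rightarrow> nat list) \<Rightarrow> nat \<Rightarrow> ('w \<times> (nat \<Rightarrow> 'u)) measure" where
  "Fstar N P U Ubar \<psi> k =
     vimage_algebra (space (system_space N P U))
       (\<lambda>x. (fst x, \<lambda>j\<in>{1..k}. ubar \<psi> j x)) (P \<Otimes>\<^sub>M Pi\<^sub>M {1..k} (\<lambda>_. Ubar))"

definition property_C ::
  "nat \<Rightarrow> 'w measure \<Rightarrow> (nat \<Rightarrow> 'u measure) \<Rightarrow> 'u measure \<Rightarrow> 'y measure \<Rightarrow>
     (nat \<Rightarrow> 'w \<times> (nat \<Rightarrow> 'u) \<Rightarrow> 'y) \<Rightarrow> bool" where
  "property_C N P U Ubar Ybar \<eta> \<longleftrightarrow>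
     (\<exists>\<psi>. ordering_map N P U \<psi> \<and>
       (\<forall>k\<in>{1..N}. \<forall>s\<in>orderings N k.
          {E \<inter> {x \<in> space (system_space N P U). take k (\<psi> x) = s} | E.
             E \<in> sets (Jbar N P U Ybar \<eta> \<psi> k)}
          \<subseteq> sets (Fstar N P U Ubar \<psi> (k - 1))))"

definition closed_loop_solution ::
  "nat \<Rightarrow> (nat \<Rightarrow> 'u measure) \<Rightarrow> (nat \<Rightarrow> 'w \<times> (nat \<Rightarrow> 'u) \<Rightarrow> 'y) \<Rightarrow> (nat \<Rightarrow> 'y \<Rightarrow> 'u) \<Rightarrow>
     'w \<Rightarrow> (nat \<Rightarrow> 'u) \<Rightarrow> bool" where
  "closed_loop_solution N U \<eta> \<gamma> \<omega> u \<longleftrightarrow>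
     u \<in> space (Pi\<^sub>M {1..N} U) \<and> (\<forall>i\<in>{1..N}. u i = \<gamma> i (\<eta> i (\<omega>, u)))"

definition property_SM ::
  "nat \<Rightarrow> 'w measure \<Rightarrow> (nat \<Rightarrow> 'u measure) \<Rightarrow> (nat \<Rightarrow> 'y measure) \<Rightarrow>
     (nat \<Rightarrow> 'w \<times> (nat \<Rightarrow> 'u) \<Rightarrow> 'y) \<Rightarrow> bool" where
  "property_SM N P U Y \<eta> \<longleftrightarrow>
     (\<forall>\<gamma>\<in>policies N U Y.
        (\<forall>\<omega>\<in>space P. \<exists>!u. closed_loop_solution N U \<eta> \<gamma> \<omega> u) \<and>
        (\<lambda>\<omega>. THE u. closed_loop_solution N U \<eta> \<gamma> \<omega> u) \<in> P \<rightarrow>\<^sub>M Pi\<^sub>M {1..N} U)"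

end

theory Submission
  imports Defs
begin

text \<open>Under causality the first \<open>k\<close> entries of the ordering and the measurement of the \<open>k\<close>-th acting
  decision maker depend on a point only through \<open>\<omega>\<close> and the actions of the first \<open>k - 1\<close> acting
  decision makers: singletons of a standard Borel space are measurable, and a set in a generated
  sigma-algebra cannot separate points on which the generating map agrees. Two closed-loop solutions
  therefore agree along the common ordering. A solution is obtained from any starting point by letting
  the decision makers overwrite their actions one after the other, since the \<open>k\<close>-th overwriting does
  not affect the measurements already used. The ordering map is measurable, by induction on the
  number of entries, hence so is each overwriting step.\<close>

section \<open>Singletons and generated sigma-algebras\<close>

lemma standard_borel_singleton:
  assumes "standard_borel M" "x \<in> space M"
  shows "{x} \<in> sets M"
proof -
  obtain T where T: "completely_metrizable_space T" "space M = topspace T"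
    "sets M = sigma_sets (topspace T) {A. openin T A}"
    using assms(1) unfolding standard_borel_def by blast
  \<comment> \<open>Metrizable spaces are T1, so the complement of a point is open.\<close>
  have "t1_space T"
    using T(1) by (simp add: completely_metrizable_imp_metrizable_space metrizable_imp_t1_space)
  then have "openin T (topspace T - {x})"
    using assms(2) T(2) by (simp add: t1_space_closedin_singleton openin_diff)
  then have "topspace T - {x} \<in> sets M"
    using T(3) by auto
  then have "space M - (topspace T - {x}) \<in> sets M"
    by blast
  moreover have "space M - (topspace T - {x}) = {x}"
    using assms(2) T(2) by auto
  ultimately show ?thesis
    by simp
qed

text \<open>Not separating \<open>x\<close> from \<open>x'\<close> holds for preimages under
  \<open>f\<close> and is preserved by complements and countable unions.\<close>

lemma vimage_algebra_mem_cong: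
  assumes "A \<in> sets (vimage_algebra X f M)" "x \<in> X" "x' \<in> X" "f x = f x'"
  shows "x \<in> A \<longleftrightarrow> x' \<in> A"
proof -
  have "A \<in> sigma_sets X {f -` B \<inter> X | B. B \<in> sets M}"
    using assms(1) by (simp add: sets_vimage_algebra)
  then show ?thesis
    by induction (use assms in auto)
qed

section \<open>Combinatorics of orderings\<close>

lemma orderings_nth:
  assumes "s \<in> orderings N n" "k < n"
  shows "s ! k \<in> {1..N}"
  using assms nth_mem[of k s] unfolding orderings_def by blast

lemma orderings_set:
  assumes "s \<in> orderings N N"
  shows "set s = {1..N}"
  using assms card_subset_eq[of "{1..N}" "set s"] distinct_card[of s] by (auto simp: orderings_def)

lemma orderings_take:
  assumes "s \<in> orderings N N" "k \<le> N"
  shows "take k s \<in> orderings N k"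
  using assms set_take_subset[of k s] by (auto simp: orderings_def)

lemma finite_orderings: "finite (orderings N k)"
  by (rule finite_subset[OF _ finite_lists_length_eq[of "{1..N}" k]]) (auto simp: orderings_def)

section \<open>Dependence on earlier actions and uniqueness of solutions, for a fixed witness
  \<open>\<psi>\<close> of causality\<close>

locale causal_system = nonsequential_system +
  fixes \<psi>
  assumes ordering: "ordering_map N P U \<psi>"
    and causal: "\<And>k s E. k \<in> {1..N} \<Longrightarrow> s \<in> orderings N k \<Longrightarrow>
      E \<in> sets (Jbar N P U Ybar \<eta> \<psi> k) \<Longrightarrow>
      E \<inter> {x \<in> space (system_space N P U). take k (\<psi> x) = s} \<in> sets (Fstar N P U Ubar \<psi> (k - 1))"
begin

abbreviation "X \<equiv> system_space N P U"

lemma \<psi>_orderings: "x \<in> space X \<Longrightarrow> \<psi> x \<in> orderings N N"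
  using ordering by (auto simp: ordering_map_def)

lemma \<psi>_nth: "x \<in> space X \<Longrightarrow> k < N \<Longrightarrow> \<psi> x ! k \<in> {1..N}"
  by (rule orderings_nth[OF \<psi>_orderings])

lemma length_\<psi>: "x \<in> space X \<Longrightarrow> length (\<psi> x) = N"
  using \<psi>_orderings by (auto simp: orderings_def)

lemma ybar_space:
  assumes "x \<in> space X" "k \<in> {1..N}"
  shows "ybar \<eta> \<psi> k x \<in> space Ybar"
proof -
  have i: "\<psi> x ! (k - 1) \<in> {1..N}"
    using assms by (intro \<psi>_nth) auto
  then have "\<eta> (\<psi> x ! (k - 1)) x \<in> space (Y (\<psi> x ! (k - 1)))"
    using measurable_space[OF measurable_\<eta> assms(1)] by blast
  then show ?thesis
    using union_Y i unfolding standard_borel_union_def ybar_def by blast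
qed

lemma causal_determined_ubar:
  assumes x: "x \<in> space X" "x' \<in> space X" "fst x = fst x'" and k: "k \<in> {1..N}"
    and eq: "\<And>j. j \<in> {1..k - 1} \<Longrightarrow> ubar \<psi> j x = ubar \<psi> j x'"
  shows "take k (\<psi> x') = take k (\<psi> x) \<and> ybar \<eta> \<psi> k x' = ybar \<eta> \<psi> k x"
proof -
  \<comment> \<open>\<open>A\<close> is the joint level set through \<open>x\<close> of the
    measurement and the truncated ordering, so that \<open>x' \<in> A\<close> is exactly the
    conclusion.\<close>
  define E where "E = ybar \<eta> \<psi> k -` {ybar \<eta> \<psi> k x} \<inter> space X"
  define A where "A = E \<inter> {z \<in> space X. take k (\<psi> z) = take k (\<psi> x)}"
  have "{ybar \<eta> \<psi> k x} \<in> sets Ybar"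
    using ybar_space[OF x(1) k] union_Y
    by (auto simp: standard_borel_union_def intro: standard_borel_singleton)
  then have "E \<in> sets (Jbar N P U Ybar \<eta> \<psi> k)"
    unfolding E_def Jbar_def by (rule in_vimage_algebra)
  moreover have "take k (\<psi> x) \<in> orderings N k"
    using \<psi>_orderings[OF x(1)] k by (intro orderings_take) auto
  ultimately have "A \<in> sets (Fstar N P U Ubar \<psi> (k - 1))"
    unfolding A_def using causal[OF k] by blast
  moreover have "(fst x, \<lambda>j\<in>{1..k - 1}. ubar \<psi> j x) = (fst x', \<lambda>j\<in>{1..k - 1}. ubar \<psi> j x')"
    using x(3) eq by (auto intro!: restrict_ext)
  ultimately have "x \<in> A \<longleftrightarrow> x' \<in> A"
    unfolding Fstar_def using x by (intro vimage_algebra_mem_cong)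
  then show ?thesis
    using x(1) unfolding A_def E_def by auto
qed

text \<open>Actions are compared along the ordering at \<open>x\<close> alone, whereas
  \<open>ubar\<close> at \<open>x'\<close> reads the ordering at \<open>x'\<close>. Strong induction
  closes this gap: once the orderings agree on earlier entries, the two comparisons coincide.
  Positions count from 0.\<close>

lemma causal_determined:
  assumes x: "x \<in> space X" "x' \<in> space X" "fst x = fst x'" and m: "m < N"
    and eq: "\<And>j. j < m \<Longrightarrow> snd x' (\<psi> x ! j) = snd x (\<psi> x ! j)"
  shows "\<psi> x' ! m = \<psi> x ! m \<and> \<eta> (\<psi> x ! m) x' = \<eta> (\<psi> x ! m) x"
  using m eq
proof (induction m rule: less_induct)
  case (less m)
  have nth: "\<psi> x' ! j = \<psi> x ! j" if "j < m" for j
    using less.IH[OF that] less.prems that by auto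
  have "take (Suc m) (\<psi> x') = take (Suc m) (\<psi> x) \<and> ybar \<eta> \<psi> (Suc m) x' = ybar \<eta> \<psi> (Suc m) x"
  proof (rule causal_determined_ubar[OF x])
    fix j assume "j \<in> {1..Suc m - 1}"
    then have "j - 1 < m"
      by auto
    then show "ubar \<psi> j x = ubar \<psi> j x'"
      using nth less.prems(2) by (simp add: ubar_def)
  qed (use less.prems in auto)
  moreover from this have "\<psi> x' ! m = \<psi> x ! m"
    by (metis lessI nth_take)
  ultimately show ?case
    by (simp add: ybar_def)
qed

text \<open>Along the ordering at \<open>u\<close>, agreement of the earlier actions forces equal
  measurements and hence, through \<open>\<gamma>\<close>, equal next actions.\<close>

lemma closed_loop_solution_unique:
  assumes \<omega>: "\<omega> \<in> space P"
    and u: "closed_loop_solution N U \<eta> \<gamma> \<omega> u" and v: "closed_loop_solution N U \<eta> \<gamma> \<omega> v"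
  shows "u = v"
proof -
  have x: "(\<omega>, u) \<in> space X" "(\<omega>, v) \<in> space X"
    using assms by (auto simp: closed_loop_solution_def space_pair_measure)
  have eq: "v (\<psi> (\<omega>, u) ! m) = u (\<psi> (\<omega>, u) ! m)" if "m < N" for m
    using that
  proof (induction m rule: less_induct)
    case (less m)
    have "\<eta> (\<psi> (\<omega>, u) ! m) (\<omega>, v) = \<eta> (\<psi> (\<omega>, u) ! m) (\<omega>, u)"
      using causal_determined[OF x _ less.prems] less by simp
    then show ?case
      using u v \<psi>_nth[OF x(1) less.prems] unfolding closed_loop_solution_def by metis
  qed
  have "v i = u i" if "i \<in> {1..N}" for i
    using that eq orderings_set[OF \<psi>_orderings[OF x(1)]] length_\<psi>[OF x(1)]
    by (metis in_set_conv_nth)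
  moreover have "u \<in> Pi\<^sub>E {1..N} (\<lambda>i. space (U i))" "v \<in> Pi\<^sub>E {1..N} (\<lambda>i. space (U i))"
    using u v by (simp_all add: closed_loop_solution_def space_PiM)
  ultimately show ?thesis
    by (metis PiE_ext)
qed

section \<open>Measurability of the ordering map\<close>

text \<open>The premise on truncations is what the induction in \<open>take_\<psi>_sets\<close>
  supplies.\<close>

lemma measurable_ubar:
  assumes "k < N" "\<And>s. s \<in> orderings N (Suc k) \<Longrightarrow> {x \<in> space X. take (Suc k) (\<psi> x) = s} \<in> sets X"
  shows "ubar \<psi> (Suc k) \<in> X \<rightarrow>\<^sub>M Ubar"
proof -
  \<comment> \<open>\<open>U i\<close> carries the trace of \<open>Ubar\<close>, so its inclusion
    into the common space is measurable.\<close>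
  have sub: "(\<lambda>x. snd x i) \<in> X \<rightarrow>\<^sub>M Ubar" if i: "i \<in> {1..N}" for i
  proof -
    have "measurable_subspace (U i) Ubar"
      using union_U i by (auto simp: standard_borel_union_def)
    then have "sets (U i) = sets (restrict_space Ubar (space (U i)))"
      by (simp add: measurable_subspace_def)
    moreover have "(\<lambda>u. u) \<in> restrict_space Ubar (space (U i)) \<rightarrow>\<^sub>M Ubar"
      by (intro measurable_restrict_space1) simp
    ultimately have "(\<lambda>u. u) \<in> U i \<rightarrow>\<^sub>M Ubar"
      by (simp cong: measurable_cong_sets)
    moreover have "(\<lambda>x. snd x i) \<in> X \<rightarrow>\<^sub>M U i"
      using i by measurable
    ultimately show ?thesis
      using measurable_compose by blast
  qed
  have "(\<lambda>x. take (Suc k) (\<psi> x)) \<in> X \<rightarrow>\<^sub>M count_space (orderings N (Suc k))"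
  proof (subst measurable_count_space_eq2[OF finite_orderings], intro conjI ballI)
    show "(\<lambda>x. take (Suc k) (\<psi> x)) \<in> space X \<rightarrow> orderings N (Suc k)"
      using \<psi>_orderings assms(1) by (auto intro!: orderings_take)
    show "(\<lambda>x. take (Suc k) (\<psi> x)) -` {s} \<inter> space X \<in> sets X" if "s \<in> orderings N (Suc k)" for s
      using assms(2)[OF that] by (simp add: vimage_def Collect_conj_eq Int_commute)
  qed
  \<comment> \<open>Entry \<open>k\<close> survives the truncation, and on each of the finitely many
    pieces the map is a coordinate projection.\<close>
  then have "(\<lambda>x. snd x (take (Suc k) (\<psi> x) ! k)) \<in> X \<rightarrow>\<^sub>M Ubar"
  proof (rule measurable_compose_countable'[rotated, where I="orderings N (Suc k)"])
    fix s assume "s \<in> orderings N (Suc k)"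
    then have "s ! k \<in> {1..N}"
      by (rule orderings_nth) simp
    then show "(\<lambda>x. snd x (s ! k)) \<in> X \<rightarrow>\<^sub>M Ubar"
      by (rule sub)
  qed (rule countable_finite[OF finite_orderings])
  then show ?thesis
    unfolding ubar_def by simp
qed

text \<open>Measurability of the shorter truncations makes the first \<open>k - 1\<close> maps
  \<open>ubar\<close> measurable, so the sigma-algebra in which causality places the set lies inside
  \<open>sets X\<close>.\<close>

lemma take_\<psi>_sets:
  assumes "k \<in> {1..N}" "s \<in> orderings N k"
  shows "{x \<in> space X. take k (\<psi> x) = s} \<in> sets X"
  using assms
proof (induction k arbitrary: s rule: less_induct)
  case (less k)
  have "ubar \<psi> j \<in> X \<rightarrow>\<^sub>M Ubar" if "j \<in> {1..k - 1}" for j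
    using measurable_ubar[of "j - 1"] less.IH[of j] that less.prems(1) by auto
  then have "(\<lambda>x. (fst x, \<lambda>j\<in>{1..k - 1}. ubar \<psi> j x)) \<in> X \<rightarrow>\<^sub>M P \<Otimes>\<^sub>M Pi\<^sub>M {1..k - 1} (\<lambda>_. Ubar)"
    by (intro measurable_Pair measurable_fst measurable_restrict)
  then have "sets (Fstar N P U Ubar \<psi> (k - 1)) \<subseteq> sets X"
    unfolding Fstar_def by (rule sets_image_in_sets[OF refl])
  \<comment> \<open>Choosing the whole space as the event turns causality into a statement about the
    ordering alone.\<close>
  moreover have "space X \<in> sets (Jbar N P U Ybar \<eta> \<psi> k)"
    using sets.top[of "Jbar N P U Ybar \<eta> \<psi> k"] by (simp add: Jbar_def)
  then have "space X \<inter> {x \<in> space X. take k (\<psi> x) = s} \<in> sets (Fstar N P U Ubar \<psi> (k - 1))"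
    using causal less.prems by blast
  ultimately show ?case
    by (auto simp: Int_absorb1)
qed

lemma measurable_\<psi>: "\<psi> \<in> X \<rightarrow>\<^sub>M count_space UNIV"
proof -
  have "\<psi> \<in> X \<rightarrow>\<^sub>M count_space (orderings N N)"
  proof (subst measurable_count_space_eq2[OF finite_orderings], intro conjI ballI)
    show "\<psi> \<in> space X \<rightarrow> orderings N N"
      using \<psi>_orderings by blast
    fix s assume s: "s \<in> orderings N N"
    show "\<psi> -` {s} \<inter> space X \<in> sets X"
    \<comment> \<open>\<open>take_\<psi>_sets\<close> starts at one entry; for \<open>N = 0\<close>
      the empty list is the only ordering.\<close>
    proof (cases "N = 0")
      case True
      then have "\<psi> -` {s} \<inter> space X = space X"
        using s \<psi>_orderings by (auto simp: orderings_def)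
      then show ?thesis
        by simp
    next
      case False
      have "\<psi> -` {s} \<inter> space X = {x \<in> space X. take N (\<psi> x) = s}"
        using length_\<psi> by auto
      then show ?thesis
        using take_\<psi>_sets[of N s] False s by simp
    qed
  qed
  then show ?thesis
    by (rule measurable_compose) simp
qed

section \<open>Construction of a measurable solution by successive overwriting\<close>

text \<open>The ordering is evaluated afresh at the current point in every round, since an
  overwriting may alter its later entries. The restriction keeps the values extensional.\<close>

fun stage :: "(nat \<Rightarrow> 'c \<Rightarrow> 'b) \<Rightarrow> (nat \<Rightarrow> 'b) \<Rightarrow> nat \<Rightarrow> 'a \<Rightarrow> nat \<Rightarrow> 'b" where
  "stage \<gamma> u 0 \<omega> = u"
| "stage \<gamma> u (Suc k) \<omega> = (\<lambda>i\<in>{1..N}. if \<psi> (\<omega>, stage \<gamma> u k \<omega>) ! k = i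
     then \<gamma> i (\<eta> i (\<omega>, stage \<gamma> u k \<omega>)) else stage \<gamma> u k \<omega> i)"

lemma measurable_stage:
  assumes \<gamma>: "\<gamma> \<in> policies N U Y" and u: "u \<in> space (Pi\<^sub>M {1..N} U)"
  shows "stage \<gamma> u k \<in> P \<rightarrow>\<^sub>M Pi\<^sub>M {1..N} U"
proof (induction k)
  case 0
  have "stage \<gamma> u 0 = (\<lambda>_. u)"
    by auto
  then show ?case
    using u by simp
next
  case (Suc k)
  have pair: "(\<lambda>\<omega>. (\<omega>, stage \<gamma> u k \<omega>)) \<in> P \<rightarrow>\<^sub>M X"
    using Suc by measurable
  have "(\<lambda>\<omega>. \<lambda>i\<in>{1..N}. if \<psi> (\<omega>, stage \<gamma> u k \<omega>) ! k = i
     then \<gamma> i (\<eta> i (\<omega>, stage \<gamma> u k \<omega>)) else stage \<gamma> u k \<omega> i) \<in> P \<rightarrow>\<^sub>M Pi\<^sub>M {1..N} U"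
  proof (intro measurable_restrict measurable_If)
    fix i assume i: "i \<in> {1..N}"
    have "\<gamma> i \<in> Y i \<rightarrow>\<^sub>M U i"
      using \<gamma> i by (auto simp: policies_def)
    then show "(\<lambda>\<omega>. \<gamma> i (\<eta> i (\<omega>, stage \<gamma> u k \<omega>))) \<in> P \<rightarrow>\<^sub>M U i"
      using measurable_compose[OF measurable_compose[OF pair measurable_\<eta>[OF i]]] by blast
    show "(\<lambda>\<omega>. stage \<gamma> u k \<omega> i) \<in> P \<rightarrow>\<^sub>M U i"
      using Suc i by measurable
    have "(\<lambda>\<omega>. \<psi> (\<omega>, stage \<gamma> u k \<omega>)) \<in> P \<rightarrow>\<^sub>M count_space UNIV"
      using measurable_compose[OF pair measurable_\<psi>] .
    then show "{\<omega> \<in> space P. \<psi> (\<omega>, stage \<gamma> u k \<omega>) ! k = i} \<in> sets P"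
      by measurable
  qed
  moreover have "stage \<gamma> u (Suc k) = (\<lambda>\<omega>. \<lambda>i\<in>{1..N}. if \<psi> (\<omega>, stage \<gamma> u k \<omega>) ! k = i
     then \<gamma> i (\<eta> i (\<omega>, stage \<gamma> u k \<omega>)) else stage \<gamma> u k \<omega> i)"
    by (rule ext) simp
  ultimately show ?case
    by (simp only:)
qed

lemma stage_space:
  assumes "\<gamma> \<in> policies N U Y" "u \<in> space (Pi\<^sub>M {1..N} U)" "\<omega> \<in> space P"
  shows "(\<omega>, stage \<gamma> u k \<omega>) \<in> space X"
  using measurable_space[OF measurable_stage[OF assms(1,2)] assms(3)] assms(3)
  by (simp add: space_pair_measure)

text \<open>This is the invariant of the construction: after \<open>n\<close> rounds the first
  \<open>n\<close> decision makers, in the ordering at the current point, satisfy their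
  equations.\<close>

lemma stage_solves:
  assumes \<gamma>: "\<gamma> \<in> policies N U Y" and u: "u \<in> space (Pi\<^sub>M {1..N} U)" and \<omega>: "\<omega> \<in> space P"
    and "n \<le> N" "j < n"
  shows "stage \<gamma> u n \<omega> (\<psi> (\<omega>, stage \<gamma> u n \<omega>) ! j) =
    \<gamma> (\<psi> (\<omega>, stage \<gamma> u n \<omega>) ! j) (\<eta> (\<psi> (\<omega>, stage \<gamma> u n \<omega>) ! j) (\<omega>, stage \<gamma> u n \<omega>))"
  using assms(4,5)
proof (induction n arbitrary: j)
  case 0
  then show ?case
    by simp
next
  case (Suc n)
  define v where "v = stage \<gamma> u n \<omega>"
  define w where "w = stage \<gamma> u (Suc n) \<omega>"
  define s where "s = \<psi> (\<omega>, v)"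
  have x: "(\<omega>, v) \<in> space X" "(\<omega>, w) \<in> space X"
    unfolding v_def w_def using stage_space[OF \<gamma> u \<omega>] by blast+
  have s: "s \<in> orderings N N"
    unfolding s_def by (rule \<psi>_orderings[OF x(1)])
  have w: "w i = (if s ! n = i then \<gamma> i (\<eta> i (\<omega>, v)) else v i)" if "i \<in> {1..N}" for i
    using that by (simp add: w_def v_def s_def)
  \<comment> \<open>The round changes only the action of \<open>s ! n\<close>, which differs from
    all earlier entries.\<close>
  have agree: "w (s ! i) = v (s ! i)" if "i < n" for i
  proof -
    have "s ! n \<noteq> s ! i"
      using s that Suc.prems(1) by (auto simp: orderings_def nth_eq_iff_index_eq)
    then show ?thesis
      using w orderings_nth[OF s, of i] that Suc.prems(1) by simp
  qed
  \<comment> \<open>Only agreement strictly before \<open>j\<close> is required, so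
    \<open>j = n\<close> is covered too: the overwritten action does not affect its own
    measurement.\<close>
  have det: "\<psi> (\<omega>, w) ! j = s ! j" "\<eta> (s ! j) (\<omega>, w) = \<eta> (s ! j) (\<omega>, v)"
    using causal_determined[OF x, of j] agree Suc.prems by (auto simp: s_def)
  have "w (s ! j) = \<gamma> (s ! j) (\<eta> (s ! j) (\<omega>, v))"
  proof (cases "j = n")
    case True
    then show ?thesis
      using w orderings_nth[OF s, of j] Suc.prems(1) by simp
  next
    case False
    then have "j < n"
      using Suc.prems(2) by simp
    then show ?thesis
      using agree Suc.IH[of j] Suc.prems(1) by (simp add: v_def s_def)
  qed
  then show ?case
    unfolding w_def[symmetric] using det by simp
qed

text \<open>After \<open>N\<close> rounds the invariant reaches everyone, because a full ordering
  exhausts \<open>{1..N}\<close>.\<close>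

lemma stage_closed_loop_solution:
  assumes "\<gamma> \<in> policies N U Y" "u \<in> space (Pi\<^sub>M {1..N} U)" "\<omega> \<in> space P"
  shows "closed_loop_solution N U \<eta> \<gamma> \<omega> (stage \<gamma> u N \<omega>)"
  unfolding closed_loop_solution_def
proof (intro conjI ballI)
  show "stage \<gamma> u N \<omega> \<in> space (Pi\<^sub>M {1..N} U)"
    using stage_space[OF assms] by (simp add: space_pair_measure)
  fix i assume "i \<in> {1..N}"
  then obtain j where "j < N" "i = \<psi> (\<omega>, stage \<gamma> u N \<omega>) ! j"
    using orderings_set[OF \<psi>_orderings] length_\<psi> stage_space[OF assms] by (metis in_set_conv_nth)
  then show "stage \<gamma> u N \<omega> i = \<gamma> i (\<eta> i (\<omega>, stage \<gamma> u N \<omega>))"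
    using stage_solves[OF assms order_refl] by blast
qed

lemma solvability_measurability: "property_SM N P U Y \<eta>"
  unfolding property_SM_def
proof (intro ballI conjI)
  fix \<gamma> assume \<gamma>: "\<gamma> \<in> policies N U Y"
  \<comment> \<open>Nonempty action spaces provide a starting point \<open>u\<close> for the
    overwriting, the same for all \<omega>.\<close>
  have "space (Pi\<^sub>M {1..N} U) \<noteq> {}"
    using nonempty_U by (simp add: space_PiM PiE_eq_empty_iff)
  then obtain u where u: "u \<in> space (Pi\<^sub>M {1..N} U)"
    by blast
  note solution = stage_closed_loop_solution[OF \<gamma> u]
  show "\<exists>!u. closed_loop_solution N U \<eta> \<gamma> \<omega> u" if "\<omega> \<in> space P" for \<omega>
    using solution[OF that] closed_loop_solution_unique[OF that] by blast
  \<comment> \<open>By uniqueness the solution map is the last stage, whose measurability is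
    known.\<close>
  have "(THE u. closed_loop_solution N U \<eta> \<gamma> \<omega> u) = stage \<gamma> u N \<omega>" if "\<omega> \<in> space P" for \<omega>
    using solution[OF that] closed_loop_solution_unique[OF that] by blast
  then show "(\<lambda>\<omega>. THE u. closed_loop_solution N U \<eta> \<gamma> \<omega> u) \<in> P \<rightarrow>\<^sub>M Pi\<^sub>M {1..N} U"
    using measurable_stage[OF \<gamma> u, of N] by (simp cong: measurable_cong)
qed

end

theorem proposition2p5:
  fixes N :: nat
    and P :: "'w measure"
    and U :: "nat \<Rightarrow> 'u measure"
    and Y :: "nat \<Rightarrow> 'y measure"
    and Ubar :: "'u measure"
    and Ybar :: "'y measure"
    and \<eta> :: "nat \<Rightarrow> 'w \<times> (nat \<Rightarrow> 'u) \<Rightarrow> 'y"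
  assumes "nonsequential_system N P U Y Ubar Ybar \<eta>"
    and "property_C N P U Ubar Ybar \<eta>"
  shows "property_SM N P U Y \<eta>"
proof -
  obtain \<psi> where "ordering_map N P U \<psi>"
    and "\<forall>k\<in>{1..N}. \<forall>s\<in>orderings N k.
      {E \<inter> {x \<in> space (system_space N P U). take k (\<psi> x) = s} | E.
        E \<in> sets (Jbar N P U Ybar \<eta> \<psi> k)} \<subseteq> sets (Fstar N P U Ubar \<psi> (k - 1))"
    using assms(2) unfolding property_C_def by blast
  then have "causal_system N P U Y Ubar Ybar \<eta> \<psi>"
    using assms(1) unfolding causal_system_def causal_system_axioms_def by blast
  then show ?thesis
    by (rule causal_system.solvability_measurability)
qed

end
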